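(* Let $m\ge1$, $n=2m+1$, and let $v_{n\,0},\dots,v_{n\,(n-1)}$ be the vertices of the regular $n$-gon $H_n$ inscribed in the unit circle. Let $d_{n\,k}=2\sin(\pi k/n)$ be the signed distance from $v_{n\,0}$ to $v_{n\,k}$ (so $d_{n\,1}$ is the side length of $H_n$ and $d_{n\,n}=0$). Then for $1\le j\le m$ and $r\in\mathbb{Z}$ $$\mathscr{F}_r^{(m,j)}=(-1)^{r-1}\sum_{t=1}^m\frac{d_{n\,(2j-1)t}}{d_{n\,t}^{2r-1}}=(-1)^{r-1}\sum_{t=1}^m\frac{2\sin\left(\frac{(2j-1)\pi t}{2m+1}\right)}{\left(2\sin\left(\frac{\pi t}{2m+1}\right)\right)^{2r-1}},$$ and, with $\mathscr{F}_r^{(m,m+1)}=0$, $$\mathscr{G}_r^{(m,j)}=\mathscr{F}_r^{(m,j+1)}-\mathscr{F}_r^{(m,j)}=(-1)^{r-1}\sum_{t=1}^m\frac{d_{n\,(2j+1)t}-d_{n\,(2j-1)t}}{d_{n\,t}^{2r-1}}=(-1)^{r-1}\sum_{t=1}^m\frac{2\cos\left(\frac{2j\pi t}{2m+1}\right)}{\left(2\sin\left(\frac{\pi t}{2m+1}\right)\right)^{2r-2}}.$$ Hence for $r$ a negative integer these sums over signed diagonal lengths are integers, namely $n$ times the renumbered Fleck numbers: they equal $n\,\mathfrak{F}(1-2r,\,(j-r)\ (\bmod\ n))$ and $n\,\mathfrak{F}(2-2r,\,(j+1-r)\ (\bmod\ n))$ respectively.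
   Context: $d_{n\,k}=2\sin(\pi k/n)$ is used for all integers $k$. Fleck numbers: $\mathfrak{F}(N,a\ (\bmod\ n))=\sum_{k\equiv a\ (\mathrm{mod}\ n)}(-1)^k\binom Nk$. Rational interlacing Fibonacci sequences of dimension $m\ge1$. Let $h_k=\frac1{2k+1}\binom{m+k}{2k}$ and let $R_m$ be the $m\times m$ matrix whose first column is $(-h_1,-h_2,\dots,-h_m)^T$, whose entries $(i,i+1)$, $1\le i\le m-1$, equal $1$, and whose other entries are $0$ (it is invertible). Let $B_{\rm odd}$, $B_{\rm even}$ be the $m\times m$ matrices with $(i,j)$ entries $(-1)^{i+j-1}\binom{2j-1}{j-i}$ and $(-1)^{i+j}\binom{2j}{j-i}$ respectively (binomial coefficients with negative lower entry are $0$). For $r\in\mathbb{Z}$ and $1\le j\le m$, $\mathscr{F}_r^{(m,j)}$ (resp. $\mathscr{G}_r^{(m,j)}$) is the $(j,1)$ entry of $(2m+1)B_{\rm odd}R_m^{r}$ (resp. $(2m+1)B_{\rm even}R_m^{r}$). *)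

theory Defs
  imports "Jordan_Normal_Form.Matrix" "HOL-Number_Theory.Cong" Complex_Main
begin

definition signed_diag :: "nat \<Rightarrow> int \<Rightarrow> real" where
  "signed_diag n k = 2 * sin (pi * of_int k / of_nat n)"

text \<open>The vertices \<open>v 0, \<dots>, v (n - 1)\<close> are listed in cyclic order; the starting point on the
  unit circle and the orientation are arbitrary.\<close>

definition inscribed_regular_polygon :: "nat \<Rightarrow> (nat \<Rightarrow> complex) \<Rightarrow> bool" where
  "inscribed_regular_polygon n v \<longleftrightarrow>
     (\<exists>\<theta>::real. (\<forall>k<n. v k = cis (\<theta> + 2 * pi * of_nat k / of_nat n)) \<or>
                (\<forall>k<n. v k = cis (\<theta> - 2 * pi * of_nat k / of_nat n)))"

text \<open>Only the indices \<open>k \<le> N\<close> contribute to the sum over the whole residue class.\<close>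

definition fleck :: "nat \<Rightarrow> int \<Rightarrow> nat \<Rightarrow> int" where
  "fleck N a n = (\<Sum>k | k \<le> N \<and> [int k = a] (mod int n). (-1) ^ k * int (N choose k))"

definition h_coeff :: "nat \<Rightarrow> nat \<Rightarrow> rat" where
  "h_coeff m k = of_nat ((m + k) choose (2 * k)) / of_nat (2 * k + 1)"

text \<open>Rows and columns of the matrix type are numbered from 0, those of the formulas from 1.\<close>

definition mat1 :: "nat \<Rightarrow> (nat \<Rightarrow> nat \<Rightarrow> rat) \<Rightarrow> rat mat" where
  "mat1 m e = mat m m (\<lambda>(i, j). e (i + 1) (j + 1))"

definition R_mat :: "nat \<Rightarrow> rat mat" where
  "R_mat m = mat1 m (\<lambda>i j. if j = 1 then - h_coeff m i else if j = i + 1 then 1 else 0)"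

definition B_odd :: "nat \<Rightarrow> rat mat" where
  "B_odd m = mat1 m (\<lambda>i j. if i \<le> j
     then (-1) ^ (i + j - 1) * of_nat ((2 * j - 1) choose (j - i)) else 0)"

definition B_even :: "nat \<Rightarrow> rat mat" where
  "B_even m = mat1 m (\<lambda>i j. if i \<le> j
     then (-1) ^ (i + j) * of_nat ((2 * j) choose (j - i)) else 0)"

text \<open>The integer power in the ring of matrices: for \<open>r < 0\<close> it is the ring-theoretic inverse
  of the power with exponent \<open>- r\<close>.\<close>

definition R_pow :: "nat \<Rightarrow> int \<Rightarrow> rat mat" where
  "R_pow m r = R_mat m [^]\<^bsub>ring_mat TYPE(rat) m ()\<^esub> r"

text \<open>The value at \<open>j = m + 1\<close> is 0 by convention; only \<open>1 \<le> j \<le> m + 1\<close> is meaningful.\<close>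

definition F_seq :: "nat \<Rightarrow> nat \<Rightarrow> int \<Rightarrow> rat" where
  "F_seq m j r = (if j = m + 1 then 0
     else (of_nat (2 * m + 1) \<cdot>\<^sub>m (B_odd m * R_pow m r)) $$ (j - 1, 0))"

definition G_seq :: "nat \<Rightarrow> nat \<Rightarrow> int \<Rightarrow> rat" where
  "G_seq m j r = (of_nat (2 * m + 1) \<cdot>\<^sub>m (B_even m * R_pow m r)) $$ (j - 1, 0)"

lemma h_coeff_top: "h_coeff m m = 1 / of_nat (2 * m + 1)"
  by (simp add: h_coeff_def flip: mult_2)

lemma R_mat_unit:
  assumes "m \<ge> 1"
  shows "R_mat m \<in> Units (ring_mat TYPE(rat) m ())"
proof -
  define S where "S = mat1 m (\<lambda>i j. (if i = j + 1 then 1 else 0) -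
     (if j = m then (if i = 1 then 1 else h_coeff m (i - 1)) / h_coeff m m else 0))"
  have h: "h_coeff m m \<noteq> 0" by (simp add: h_coeff_top del: of_nat_Suc)
  have c: "R_mat m \<in> carrier_mat m m" "S \<in> carrier_mat m m"
    by (auto simp: R_mat_def S_def mat1_def)
  have 1: "R_mat m * S = 1\<^sub>m m"
  proof (rule eq_matI)
    fix i j assume ij: "i < dim_row (1\<^sub>m m :: rat mat)" "j < dim_col (1\<^sub>m m :: rat mat)"
    then have ij: "i < m" "j < m" by auto
    have "(R_mat m * S) $$ (i, j) = (\<Sum>k\<in>{0..<m}. R_mat m $$ (i, k) * S $$ (k, j))"
      using ij c by (auto simp: scalar_prod_def)
    also have "\<dots> = (\<Sum>k\<in>{0..<m}. (if k = 0 then - h_coeff m (i + 1) * S $$ (0, j) else 0) +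
        (if k = i + 1 then S $$ (i + 1, j) else 0))"
      using ij by (intro sum.cong) (auto simp: R_mat_def mat1_def)
    also have "\<dots> = - h_coeff m (i + 1) * S $$ (0, j) + (if i + 1 < m then S $$ (i + 1, j) else 0)"
      using ij by (simp add: sum.distrib)
    also have "\<dots> = 1\<^sub>m m $$ (i, j)"
      using ij h by (cases "i + 1 = m") (auto simp: S_def mat1_def)
    finally show "(R_mat m * S) $$ (i, j) = 1\<^sub>m m $$ (i, j)" .
  qed (use c in auto)
  have 2: "S * R_mat m = 1\<^sub>m m"
  proof (rule eq_matI)
    fix i j assume ij: "i < dim_row (1\<^sub>m m :: rat mat)" "j < dim_col (1\<^sub>m m :: rat mat)"
    then have ij: "i < m" "j < m" by auto
    let ?g = "(if i = 0 then 1 else h_coeff m i) / h_coeff m m"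
    have "(S * R_mat m) $$ (i, j) = (\<Sum>k\<in>{0..<m}. S $$ (i, k) * R_mat m $$ (k, j))"
      using ij c by (auto simp: scalar_prod_def)
    also have "\<dots> = (\<Sum>k\<in>{0..<m}. (if k = i - 1 then (if i = 0 then 0 else R_mat m $$ (i - 1, j)) else 0) -
        (if k = m - 1 then ?g * R_mat m $$ (m - 1, j) else 0))"
      using ij by (intro sum.cong) (auto simp: S_def mat1_def algebra_simps)
    also have "\<dots> = (if i = 0 then 0 else R_mat m $$ (i - 1, j)) - ?g * R_mat m $$ (m - 1, j)"
      using ij by (simp add: sum_subtractf)
    also have "\<dots> = 1\<^sub>m m $$ (i, j)"
      using ij h by (auto simp: R_mat_def mat1_def)
    finally show "(S * R_mat m) $$ (i, j) = 1\<^sub>m m $$ (i, j)" .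
  qed (use c in auto)
  show ?thesis
    using c 1 2 by (auto simp: Units_def ring_mat_def)
qed

end

theory Submission
  imports Defs
begin

text \<open>
  Three families indexed by an integer \<open>r\<close> and a position \<open>j\<close> are to be compared: the entries of
  \<open>(2 m + 1) B_odd R_mat\<^sup>r\<close> in the first column, the sums over signed diagonals, and, for \<open>r \<le> 0\<close>,
  \<open>2 m + 1\<close> times Fleck numbers. All of them obey the same rule: extended to \<open>j = 0\<close> and
  \<open>j = m + 1\<close> they satisfy \<open>x 0 = - x 1\<close> and \<open>x (m + 1) = 0\<close>, and passing from \<open>r\<close> to \<open>r - 1\<close> replaces
  the vector \<open>x\<close> by its second differences \<open>x (j + 1) - 2 x j + x (j - 1)\<close>. They also agree
  at \<open>r = 0\<close>, where each is \<open>- (2 m + 1)\<close> at \<open>j = 1\<close> and \<open>0\<close> at the other positions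
  \<open>2, \<dots>, m\<close>. Under the boundary conditions the second difference operator is injective
  (\<open>second_difference_inj\<close>), so such a family is determined in both directions by its value at
  \<open>r = 0\<close> (\<open>orbit_eq\<close>, \<open>orbit_eq_backward\<close>).

  For the diagonal sums the rule is the identity that multiplication by
  \<open>- (2 sin a)\<^sup>2\<close>, which equals \<open>2 cos (2 a) - 2\<close>, is a second difference in the frequency
  (\<open>diagonal_sum_orbit\<close>). For Fleck numbers it is Pascal's rule applied twice (\<open>fleck_orbit\<close>). For the
  matrices it says that \<open>B_odd\<close> conjugates the inverse of \<open>R_mat\<close> into the tridiagonal second
  difference matrix (\<open>F_row_orbit\<close>): Pascal's rule moves each column of \<open>B_odd\<close> to the next, and the
  coefficients \<open>h\<close> are those of the one linear relation that expresses the truncated column \<open>m + 1\<close> through the others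
  (\<open>sum_h_coeff_B_odd_entry\<close>), which is the vanishing of an \<open>N\<close>-th difference of a polynomial of
  degree \<open>N - 1\<close>.

  The statements about \<open>G_seq\<close> follow because consecutive rows of \<open>B_odd\<close> differ by a row of
  \<open>B_even\<close>, and likewise for the sums and the Fleck numbers.
\<close>

section \<open>Alternating binomial sums\<close>

text \<open>Pascal's rule turns one factor of an \<open>(N + 1)\<close>-fold difference into a difference of the
  summand; this is the induction step for sums against alternating binomial coefficients.\<close>
lemma alternating_choose_sum_shift:
  fixes f :: "nat \<Rightarrow> 'a::comm_ring_1"
  shows "(\<Sum>l\<le>Suc N. (-1) ^ l * of_nat (Suc N choose l) * f l) =
         (\<Sum>l\<le>N. (-1) ^ l * of_nat (N choose l) * (f l - f (Suc l)))"
proof -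
  have "(\<Sum>l\<le>Suc N. (-1) ^ l * of_nat (Suc N choose l) * f l) =
      f 0 - (\<Sum>l\<le>N. (-1) ^ l * of_nat (N choose l) * f (Suc l))
          - (\<Sum>l\<le>N. (-1) ^ l * of_nat (N choose Suc l) * f (Suc l))"
    unfolding sum.atMost_Suc_shift
    by (simp add: distrib_left distrib_right left_diff_distrib sum.distrib sum_negf sum_subtractf)
  also have "\<dots> = (\<Sum>l\<le>Suc N. (-1) ^ l * of_nat (N choose l) * f l) -
      (\<Sum>l\<le>N. (-1) ^ l * of_nat (N choose l) * f (Suc l))"
    unfolding sum.atMost_Suc_shift by (simp add: sum_negf)
  also have "\<dots> = (\<Sum>l\<le>N. (-1) ^ l * of_nat (N choose l) * (f l - f (Suc l)))"
    by (simp add: right_diff_distrib sum_subtractf binomial_eq_0)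
  finally show ?thesis .
qed

text \<open>The \<open>N\<close>-th finite difference annihilates \<open>l \<mapsto> (a + l) choose d\<close>, which is a polynomial
  in \<open>l\<close> of degree \<open>d < N\<close>.\<close>
lemma alternating_choose_sum_zero:
  assumes "d < N"
  shows "(\<Sum>l\<le>N. (-1) ^ l * of_nat (N choose l) * of_nat ((a + l) choose d)) = (0::'a::comm_ring_1)"
  using assms
proof (induction N arbitrary: d)
  case (Suc N)
  show ?case
  proof (cases d)
    case 0
    show ?thesis unfolding alternating_choose_sum_shift by (simp add: 0)
  next
    case (Suc e)
    have "(\<Sum>l\<le>N. (-1) ^ l * of_nat (N choose l) * of_nat ((a + l) choose e)) = (0::'a)"
      using Suc.IH[of e] Suc Suc.prems by simp
    then show ?thesis unfolding alternating_choose_sum_shift by (simp add: Suc sum_negf)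
  qed
qed simp

section \<open>The columns of \<open>B_odd\<close>\<close>

text \<open>The entry formula of \<open>B_odd\<close> is used for all row indices. In row \<open>0\<close> it gives the negative of
  row \<open>1\<close>, and in row \<open>m + 1\<close> it vanishes on the first \<open>m\<close> columns, so that these two rows supply
  the boundary values for the second difference operator.\<close>
definition B_odd_entry :: "nat \<Rightarrow> nat \<Rightarrow> rat" where
  "B_odd_entry j i =
     (if j \<le> i then (-1) ^ (i + j - 1) * of_nat ((2 * i - 1) choose (i - j)) else 0)"

lemma B_odd_entry_0:
  assumes "i \<ge> 1" shows "B_odd_entry 0 i = - B_odd_entry 1 i"
proof -
  obtain k where "i = Suc k" using assms by (cases i) auto
  then show ?thesis
    using binomial_symmetric[of k "2 * k + 1"] by (simp add: B_odd_entry_def)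
qed

text \<open>Up to the sign \<open>(-1) ^ i\<close>, column \<open>i\<close> lists the coefficients of \<open>(2 sin x) ^ (2 i - 1)\<close> with
  respect to the functions \<open>2 sin ((2 j - 1) x)\<close>. Passing to the next column is multiplication by \<open>- (2 sin x)\<^sup>2\<close>, which acts
  as a second difference on these coefficients: Pascal's rule applied twice.\<close>
lemma B_odd_entry_second_difference:
  assumes "j \<ge> 1" "i \<ge> 1"
  shows "B_odd_entry j (Suc i) =
           B_odd_entry (Suc j) i - 2 * B_odd_entry j i + B_odd_entry (j - 1) i"
proof -
  obtain p where p: "j = Suc p" using assms by (cases j) auto
  consider "j > Suc i" | "j = Suc i" | "j = i" | d where "i = j + Suc d"
    by (metis linorder_neqE_nat less_Suc_eq less_iff_Suc_add add_Suc_right not_less_eq)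
  then show ?thesis
  proof cases
    case 4
    have s: "i - j = Suc d" "Suc i - j = Suc (Suc d)" "i - Suc j = d" "i - p = Suc (Suc d)"
      "2 * Suc i - 1 = Suc (Suc (2 * i - 1))"
      using 4 p by auto
    have e: "(-1::rat) ^ (Suc i + j - 1) = - ((-1) ^ d)" "(-1::rat) ^ (i + Suc j - 1) = - ((-1) ^ d)"
      "(-1::rat) ^ (i + j - 1) = (-1) ^ d" "(-1::rat) ^ (i + p - 1) = - ((-1) ^ d)"
      by (simp_all add: 4 p minus_one_power_iff)
    have "B_odd_entry j (Suc i) = - ((-1) ^ d) * of_nat (Suc (Suc (2 * i - 1)) choose Suc (Suc d))"
      "B_odd_entry (Suc j) i = - ((-1) ^ d) * of_nat ((2 * i - 1) choose d)"
      "B_odd_entry j i = (-1) ^ d * of_nat ((2 * i - 1) choose Suc d)"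
      "B_odd_entry (j - 1) i = - ((-1) ^ d) * of_nat ((2 * i - 1) choose Suc (Suc d))"
      unfolding B_odd_entry_def using 4 s e by (simp_all add: p)
    then show ?thesis by (simp add: algebra_simps)
  qed (use assms in \<open>auto simp: B_odd_entry_def p\<close>)
qed

text \<open>This linear relation between columns \<open>1, \<dots>, m + 1\<close> is what ties the coefficients \<open>h\<close> in the
  first column of \<open>R_mat\<close> to \<open>B_odd\<close>. It encodes the expansion of \<open>sin ((2 m + 1) x)\<close> in odd powers of \<open>sin x\<close>, which has no component along
  \<open>sin ((2 j - 1) x)\<close> for \<open>j \<le> m\<close>. In terms of \<open>l = k + 1 - j\<close> and \<open>N = m + 1 - j\<close> the factorials of
  each summand regroup into \<open>(N choose l) * ((m + k) choose (N - 1))\<close>, a summand of an \<open>N\<close>-th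
  difference of a polynomial of degree \<open>N - 1\<close>.\<close>
lemma sum_h_coeff_B_odd_entry:
  assumes "1 \<le> j" "j \<le> m"
  shows "(\<Sum>k\<le>m. h_coeff m k * B_odd_entry j (Suc k)) = 0"
proof -
  define N where "N = m + 1 - j"
  have N: "N \<ge> 1" "m + 1 = N + j" using assms by (auto simp: N_def)
  \<comment> \<open>The terms with \<open>k < j - 1\<close> lie below the diagonal of the triangular matrix and vanish.\<close>
  have split: "{..m} = {..<j - 1} \<union> (\<lambda>l. j - 1 + l) ` {..N}"
  proof -
    have "k \<in> (\<lambda>l. j - 1 + l) ` {..N}" if "k \<le> m" "\<not> k < j - 1" for k
      using that N by (intro image_eqI[of _ _ "k - (j - 1)"]) auto
    then show ?thesis using N assms by auto
  qed
  have summand: "h_coeff m (j - 1 + l) * B_odd_entry j (Suc (j - 1 + l)) =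
     - ((-1) ^ l * of_nat (N choose l) * of_nat ((m + j - 1 + l) choose (N - 1))) / of_nat N"
    if l: "l \<le> N" for l
  proof -
    define k where "k = j - 1 + l"
    have k: "k \<le> m" "k + 1 = j + l" using l N assms by (auto simp: k_def)
    have sg: "(-1::rat) ^ (Suc k + j - 1) = - ((-1) ^ l)"
    proof -
      have "Suc k + j - 1 = Suc (2 * (j - 1) + l)" using k assms by auto
      then show ?thesis by (simp add: minus_one_power_iff)
    qed
    have 1: "(of_nat ((m + k) choose (2 * k)) :: rat) = fact (m + k) / (fact (2 * k) * fact (m - k))"
      using k by (subst binomial_fact) (auto simp: mult_2)
    have 2: "(of_nat ((2 * k + 1) choose l) :: rat) = fact (2 * k + 1) / (fact l * fact (k + j))"
    proof -
      have "2 * k + 1 - l = k + j" "l \<le> 2 * k + 1" using k assms by auto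
      then show ?thesis by (subst binomial_fact) auto
    qed
    have 3: "(of_nat (N choose l) :: rat) = fact N / (fact l * fact (m - k))"
    proof -
      have "N - l = m - k" using k N by auto
      then show ?thesis using l by (subst binomial_fact) auto
    qed
    have 4: "(of_nat ((m + k) choose (N - 1)) :: rat) = fact (m + k) / (fact (N - 1) * fact (k + j))"
    proof -
      have "m + k - (N - 1) = k + j" "N - 1 \<le> m + k" using N k assms by auto
      then show ?thesis by (subst binomial_fact) auto
    qed
    have 5: "(fact N :: rat) = of_nat N * fact (N - 1)"
      using N by (subst fact_reduce) auto
    have 6: "(fact (2 * k + 1) :: rat) = of_nat (2 * k + 1) * fact (2 * k)"
      by simp
    have kk: "m + j - 1 + l = m + k" "Suc k - j = l" "2 * Suc k - 1 = 2 * k + 1" "j \<le> Suc k"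
      using k assms by auto
    have "h_coeff m k * B_odd_entry j (Suc k) =
        - ((-1) ^ l) * (of_nat ((m + k) choose (2 * k)) * of_nat ((2 * k + 1) choose l) / of_nat (2 * k + 1))"
      unfolding h_coeff_def B_odd_entry_def kk(2,3) sg using kk(4) by simp
    also have "of_nat ((m + k) choose (2 * k)) * of_nat ((2 * k + 1) choose l) / of_nat (2 * k + 1) =
        (of_nat (N choose l) * of_nat ((m + k) choose (N - 1)) / of_nat N :: rat)"
      unfolding 1 2 3 4 unfolding 5 6 using N(1) by (simp add: field_simps del: of_nat_Suc of_nat_add)
    finally show ?thesis unfolding kk(1) k_def[symmetric] by simp
  qed
  have "(\<Sum>k\<le>m. h_coeff m k * B_odd_entry j (Suc k)) =
      (\<Sum>k<j - 1. h_coeff m k * B_odd_entry j (Suc k)) +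
      (\<Sum>l\<le>N. h_coeff m (j - 1 + l) * B_odd_entry j (Suc (j - 1 + l)))"
    unfolding split by (subst sum.union_disjoint) (auto simp: sum.reindex)
  also have "(\<Sum>k<j - 1. h_coeff m k * B_odd_entry j (Suc k)) = 0"
    by (intro sum.neutral) (auto simp: B_odd_entry_def)
  also have "(\<Sum>l\<le>N. h_coeff m (j - 1 + l) * B_odd_entry j (Suc (j - 1 + l))) =
      - (\<Sum>l\<le>N. (-1) ^ l * of_nat (N choose l) * of_nat ((m + j - 1 + l) choose (N - 1))) / of_nat N"
  proof -
    have "(\<Sum>l\<le>N. h_coeff m (j - 1 + l) * B_odd_entry j (Suc (j - 1 + l))) =
        (\<Sum>l\<le>N. - ((-1) ^ l * of_nat (N choose l) *
           of_nat ((m + j - 1 + l) choose (N - 1))) / of_nat N)"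
      by (intro sum.cong refl summand) simp
    then show ?thesis by (simp only: sum_negf sum_divide_distrib[symmetric])
  qed
  also have "\<dots> = 0"
    using N by (subst alternating_choose_sum_zero) auto
  finally show ?thesis by simp
qed

section \<open>Integer powers of \<open>R_mat\<close>\<close>

text \<open>The units of a monoid form a group whose integer powers agree with those of the monoid, so the
  exponent law can be taken from there.\<close>
lemma
  assumes "monoid G" "x \<in> Units G"
  shows unit_int_pow_step: "x [^]\<^bsub>G\<^esub> (r::int) = x \<otimes>\<^bsub>G\<^esub> x [^]\<^bsub>G\<^esub> (r - 1)"
    and unit_int_pow_closed: "x [^]\<^bsub>G\<^esub> (r::int) \<in> carrier G"
proof -
  interpret monoid G by fact
  interpret U: group "units_of G" by (rule units_group)
  have nat: "x [^]\<^bsub>units_of G\<^esub> (k::nat) = x [^]\<^bsub>G\<^esub> k" for k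
    using assms(2) by (rule units_of_pow)
  have memn: "x [^]\<^bsub>G\<^esub> (k::nat) \<in> Units G" for k
    using U.nat_pow_closed[of x k] assms(2) nat by (simp add: units_of_carrier)
  have int: "x [^]\<^bsub>units_of G\<^esub> (s::int) = x [^]\<^bsub>G\<^esub> s" for s
    unfolding int_pow_def2 nat units_of_inv[OF memn] ..
  have "x [^]\<^bsub>units_of G\<^esub> (1 + (r - 1)) =
      x [^]\<^bsub>units_of G\<^esub> (1::int) \<otimes>\<^bsub>units_of G\<^esub> x [^]\<^bsub>units_of G\<^esub> (r - 1)"
    using assms(2) by (intro U.int_pow_mult) (simp add: units_of_carrier)
  then show "x [^]\<^bsub>G\<^esub> (r::int) = x \<otimes>\<^bsub>G\<^esub> x [^]\<^bsub>G\<^esub> (r - 1)"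
    using assms(2) U.int_pow_1[of x] by (simp add: int units_of_mult units_of_carrier)
  show "x [^]\<^bsub>G\<^esub> (r::int) \<in> carrier G"
    using U.int_pow_closed[of x r] assms(2) by (simp add: int units_of_carrier Units_closed)
qed

lemma
  assumes "m \<ge> 1"
  shows R_pow_step: "R_pow m r = R_mat m * R_pow m (r - 1)"
    and R_pow_carrier: "R_pow m r \<in> carrier_mat m m"
    and R_pow_0: "R_pow m 0 = 1\<^sub>m m"
proof -
  have mon: "monoid (ring_mat TYPE(rat) m ())"
    using ring_mat by (rule ring.is_monoid)
  show "R_pow m r = R_mat m * R_pow m (r - 1)" "R_pow m r \<in> carrier_mat m m"
    using unit_int_pow_step[OF mon R_mat_unit[OF assms], of r]
      unit_int_pow_closed[OF mon R_mat_unit[OF assms], of r]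
    by (simp_all add: R_pow_def ring_mat_simps)
  show "R_pow m 0 = 1\<^sub>m m"
    by (simp add: R_pow_def int_pow_def2 ring_mat_simps)
qed

text \<open>Only the first column of a power of \<open>R_mat\<close> enters the sequences. Left multiplication by
  \<open>R_mat\<close> shifts it up by one and subtracts a multiple of the vector of coefficients \<open>h\<close>.\<close>
lemma R_pow_column_step:
  assumes "i < m"
  shows "R_pow m r $$ (i, 0) = - h_coeff m (i + 1) * R_pow m (r - 1) $$ (0, 0) +
           (if i + 1 < m then R_pow m (r - 1) $$ (i + 1, 0) else 0)"
proof -
  let ?P = "R_pow m (r - 1)"
  have m: "m \<ge> 1" using assms by simp
  have c: "R_mat m \<in> carrier_mat m m" "?P \<in> carrier_mat m m"
    using R_pow_carrier[OF m] by (auto simp: R_mat_def mat1_def)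
  have "(R_mat m * ?P) $$ (i, 0) = (\<Sum>k\<in>{0..<m}. R_mat m $$ (i, k) * ?P $$ (k, 0))"
    using assms c by (auto simp: scalar_prod_def)
  also have "\<dots> = (\<Sum>k\<in>{0..<m}. (if k = 0 then - h_coeff m (i + 1) * ?P $$ (0, 0) else 0) +
      (if k = i + 1 then ?P $$ (i + 1, 0) else 0))"
    using assms by (intro sum.cong) (auto simp: R_mat_def mat1_def)
  also have "\<dots> = - h_coeff m (i + 1) * ?P $$ (0, 0) +
      (if i + 1 < m then ?P $$ (i + 1, 0) else 0)"
    using assms by (simp add: sum.distrib)
  finally show ?thesis unfolding R_pow_step[OF m, of r, symmetric] .
qed

text \<open>The sequence \<open>F_seq\<close> with its row index extended to \<open>0\<close> and \<open>m + 1\<close> through the formula for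
  the matrix entries. At \<open>m + 1\<close> this reproduces the convention that the value is \<open>0\<close>.\<close>
definition F_row :: "nat \<Rightarrow> int \<Rightarrow> nat \<Rightarrow> rat" where
  "F_row m r j = of_nat (2 * m + 1) * (\<Sum>i<m. B_odd_entry j (Suc i) * R_pow m r $$ (i, 0))"

lemma F_seq_eq_F_row:
  assumes "1 \<le> j" "j \<le> m + 1"
  shows "F_seq m j r = F_row m r j"
proof (cases "j = m + 1")
  case True
  then show ?thesis by (simp add: F_seq_def F_row_def B_odd_entry_def)
next
  case False
  then have j: "j - 1 < m" "m \<ge> 1" "j \<le> m" using assms by auto
  have c: "B_odd m \<in> carrier_mat m m" "R_pow m r \<in> carrier_mat m m"
    using R_pow_carrier[OF j(2)] by (auto simp: B_odd_def mat1_def)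
  have "(B_odd m * R_pow m r) $$ (j - 1, 0) = (\<Sum>i\<in>{0..<m}. B_odd m $$ (j - 1, i) * R_pow m r $$ (i, 0))"
    using j c by (auto simp: scalar_prod_def)
  also have "\<dots> = (\<Sum>i<m. B_odd_entry j (Suc i) * R_pow m r $$ (i, 0))"
    using j assms(1) by (intro sum.cong) (auto simp: B_odd_def mat1_def B_odd_entry_def add.commute)
  finally show ?thesis using j c by (simp add: F_seq_def F_row_def)
qed

text \<open>By Pascal's rule each row of \<open>B_even\<close> is the difference of two consecutive rows of \<open>B_odd\<close>; for
  the last row this uses the extra row \<open>m + 1\<close>.\<close>
lemma G_seq_eq_F_row:
  assumes "1 \<le> j" "j \<le> m"
  shows "G_seq m j r = F_row m r (j + 1) - F_row m r j"
proof -
  have j: "j - 1 < m" "m \<ge> 1" using assms by auto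
  have c: "B_even m \<in> carrier_mat m m" "R_pow m r \<in> carrier_mat m m"
    using R_pow_carrier[OF j(2)] by (auto simp: B_even_def mat1_def)
  have pascal: "B_even m $$ (j - 1, i) = B_odd_entry (Suc j) (Suc i) - B_odd_entry j (Suc i)"
    if "i < m" for i
  proof -
    consider "j > Suc i" | "j = Suc i" | d where "i = j + d"
      by (metis linorder_neqE_nat not_less_eq le_iff_add less_Suc_eq_le)
    then show ?thesis
    proof cases
      case 3
      have "B_even m $$ (j - 1, i) =
          - ((-1) ^ d) * of_nat (Suc (Suc (2 * (j + d))) choose Suc d)"
        using that assms 3 by (simp add: B_even_def mat1_def minus_one_power_iff Suc_diff_le)
      moreover have "B_odd_entry (Suc j) (Suc i) =
          - ((-1) ^ d) * of_nat (Suc (2 * (j + d)) choose d)"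
        using 3 by (simp add: B_odd_entry_def minus_one_power_iff)
      moreover have "B_odd_entry j (Suc i) =
          (-1) ^ d * of_nat (Suc (2 * (j + d)) choose Suc d)"
        using 3 by (simp add: B_odd_entry_def minus_one_power_iff Suc_diff_le)
      ultimately show ?thesis by (simp add: algebra_simps)
    qed (use that assms in \<open>auto simp: B_even_def mat1_def B_odd_entry_def\<close>)
  qed
  have "(B_even m * R_pow m r) $$ (j - 1, 0) = (\<Sum>i\<in>{0..<m}. B_even m $$ (j - 1, i) * R_pow m r $$ (i, 0))"
    using j c by (auto simp: scalar_prod_def)
  also have "\<dots> = (\<Sum>i<m. (B_odd_entry (Suc j) (Suc i) - B_odd_entry j (Suc i)) * R_pow m r $$ (i, 0))"
    unfolding atLeast0LessThan by (intro sum.cong refl) (simp only: pascal lessThan_iff)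
  finally have "(B_even m * R_pow m r) $$ (j - 1, 0) =
      (\<Sum>i<m. B_odd_entry (j + 1) (Suc i) * R_pow m r $$ (i, 0)) -
      (\<Sum>i<m. B_odd_entry j (Suc i) * R_pow m r $$ (i, 0))"
    by (simp add: left_diff_distrib sum_subtractf)
  then show ?thesis using j c
    by (simp add: G_seq_def F_row_def flip: right_diff_distrib)
qed

section \<open>Orbits of the second difference operator\<close>

text \<open>Boundary conditions for vectors indexed by \<open>0, \<dots>, m + 1\<close>: they are odd about the half-integer
  \<open>1 / 2\<close> and vanish at the other end, like \<open>j \<mapsto> sin ((2 j - 1) \<pi> t / (2 m + 1))\<close>.\<close>
definition odd_boundary :: "nat \<Rightarrow> (nat \<Rightarrow> real) \<Rightarrow> bool" where
  "odd_boundary m x \<longleftrightarrow> x 0 = - x 1 \<and> x (Suc m) = 0"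

definition second_difference :: "(nat \<Rightarrow> real) \<Rightarrow> nat \<Rightarrow> real" where
  "second_difference x j = x (Suc j) - 2 * x j + x (j - 1)"

text \<open>The difference of \<open>x\<close> and \<open>y\<close> has vanishing second differences and hence is affine. Oddness about \<open>1 / 2\<close> forces it to be a
  multiple of \<open>2 j - 1\<close>, and the zero at \<open>m + 1\<close> forces the multiple to be \<open>0\<close>.\<close>
lemma second_difference_inj:
  assumes "odd_boundary m x" "odd_boundary m y"
    and "\<And>j. j \<in> {1..m} \<Longrightarrow> second_difference x j = second_difference y j"
    and "j \<le> Suc m"
  shows "x j = y j"
proof -
  define z where "z j = x j - y j" for j
  have step: "z (Suc j) = 2 * z j - z (j - 1)" if "j \<in> {1..m}" for j
    using assms(3)[of j] that by (auto simp: z_def second_difference_def)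
  have z0: "z 0 = - z 1" and zm: "z (Suc m) = 0"
    using assms(1,2) by (auto simp: z_def odd_boundary_def)
  have lin: "k \<le> m \<Longrightarrow> z k = (2 * real k - 1) * z 1 \<and> z (Suc k) = (2 * real k + 1) * z 1" for k
  proof (induction k)
    case (Suc k)
    then show ?case using step[of "Suc k"] by (simp add: algebra_simps)
  qed (simp add: z0)
  have "(2 * real m + 1) * z 1 = 0" using lin[of m] zm by simp
  then have "z 1 = 0" by (simp add: add_nonneg_eq_0_iff)
  then have "z j = 0" using lin[of j] zm assms(4) by (cases "j \<le> m") (simp_all add: le_Suc_eq)
  then show ?thesis by (simp add: z_def)
qed

text \<open>The operator lowers the index \<open>r\<close>, as \<open>R_mat\<close> raises it. The index set is a parameter because
  Fleck numbers give an orbit for \<open>r \<le> 0\<close> only.\<close>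
definition second_difference_orbit :: "int set \<Rightarrow> nat \<Rightarrow> (int \<Rightarrow> nat \<Rightarrow> real) \<Rightarrow> bool" where
  "second_difference_orbit I m X \<longleftrightarrow> (\<forall>r\<in>I. odd_boundary m (X r) \<and>
     (\<forall>j\<in>{1..m}. X (r - 1) j = second_difference (X r) j))"

lemma orbit_eq_backward:
  assumes X: "second_difference_orbit {..0} m X" and Y: "second_difference_orbit {..0} m Y"
    and zero: "\<And>j. j \<in> {1..m} \<Longrightarrow> X 0 j = Y 0 j" and m: "m \<ge> 1"
    and r: "r \<le> 0" and j: "j \<in> {1..m}"
  shows "X r j = Y r j"
  using r j
proof (induction r arbitrary: j rule: int_le_induct)
  case (step r)
  have ends: "odd_boundary m (X r)" "odd_boundary m (Y r)"
    using X Y step.hyps by (auto simp: second_difference_orbit_def)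
  have eq: "X r k = Y r k" if k: "k \<le> Suc m" for k
  proof -
    consider "k = 0" | "k \<in> {1..m}" | "k = Suc m" using k by (cases "k = 0"; cases "k = Suc m") auto
    then show ?thesis
      using ends step.IH[of k] step.IH[of 1] m by cases (auto simp: odd_boundary_def)
  qed
  have "X (r - 1) j = second_difference (X r) j" "Y (r - 1) j = second_difference (Y r) j"
    using X Y step.hyps step.prems by (auto simp: second_difference_orbit_def)
  moreover have "second_difference (X r) j = second_difference (Y r) j"
    unfolding second_difference_def using step.prems by (subst (1 2 3) eq) auto
  ultimately show ?case by simp
qed (use zero in auto)

text \<open>For negative \<open>r\<close> the operator is applied repeatedly; for positive \<open>r\<close> it has to be inverted, which
  is where its injectivity enters.\<close>
lemma orbit_eq:
  assumes X: "second_difference_orbit UNIV m X" and Y: "second_difference_orbit UNIV m Y"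
    and zero: "\<And>j. j \<in> {1..m} \<Longrightarrow> X 0 j = Y 0 j" and m: "m \<ge> 1"
    and j: "j \<in> {1..m}"
  shows "X r j = Y r j"
proof (cases "r \<le> 0")
  case True
  have "second_difference_orbit {..0} m X" "second_difference_orbit {..0} m Y"
    using X Y by (auto simp: second_difference_orbit_def)
  from orbit_eq_backward[OF this zero m True j] show ?thesis .
next
  case False
  then have "r \<ge> 0" by simp
  then show ?thesis using j
  proof (induction r arbitrary: j rule: int_ge_induct)
    case (step r)
    have ends: "odd_boundary m (X (r + 1))" "odd_boundary m (Y (r + 1))"
      using X Y by (auto simp: second_difference_orbit_def)
    have "second_difference (X (r + 1)) k = second_difference (Y (r + 1)) k" if "k \<in> {1..m}" for k
    proof -
      have "X (r + 1 - 1) k = second_difference (X (r + 1)) k"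
        "Y (r + 1 - 1) k = second_difference (Y (r + 1)) k"
        using X Y that unfolding second_difference_orbit_def by blast+
      then show ?thesis using step.IH[OF that] by simp
    qed
    from second_difference_inj[OF ends this] show ?case using step.prems by simp
  qed (use zero in auto)
qed

section \<open>The matrix sequences form an orbit\<close>

text \<open>The second difference operator, applied to \<open>B_odd * c\<close> where \<open>c\<close> is the first column of
  the \<open>r\<close>-th power of \<open>R_mat\<close>, replaces every column of \<open>B_odd\<close> by the next one. Substituting
  \<open>c = R_mat * d\<close>, where \<open>d\<close> is the first column of the power with exponent \<open>r - 1\<close>, restores the columns \<open>2, \<dots>, m\<close> with the coefficients of \<open>d\<close>, while all contributions of the first
  entry of \<open>d\<close> combine to column \<open>1\<close> by \<open>sum_h_coeff_B_odd_entry\<close>, whose summand \<open>k = 0\<close> has \<open>h = 1\<close>.\<close>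
lemma F_row_orbit:
  assumes m: "m \<ge> 1"
  shows "second_difference_orbit UNIV m (\<lambda>r j. real_of_rat (F_row m r j))"
proof -
  have ends: "F_row m r 0 = - F_row m r 1" "F_row m r (Suc m) = 0" for r
    by (simp_all add: F_row_def B_odd_entry_0 sum_negf) (simp add: B_odd_entry_def)
  have step: "F_row m (r - 1) j = F_row m r (Suc j) - 2 * F_row m r j + F_row m r (j - 1)"
    if j: "j \<in> {1..m}" for r j
  proof -
    let ?d = "\<lambda>i. R_pow m (r - 1) $$ (i, 0)"
    obtain p where p: "m = Suc p" using m by (cases m) auto
    have hB: "(\<Sum>i<m. h_coeff m (Suc i) * B_odd_entry j (Suc (Suc i))) = - B_odd_entry j 1"
    proof -
      have "(\<Sum>k\<le>m. h_coeff m k * B_odd_entry j (Suc k)) = 0"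
        using j by (intro sum_h_coeff_B_odd_entry) auto
      then show ?thesis
        by (simp add: sum.atMost_shift h_coeff_def eq_neg_iff_add_eq_0 add.commute)
    qed
    have shift: "(\<Sum>i<m. B_odd_entry j (Suc (Suc i)) * (if Suc i < m then ?d (Suc i) else 0)) =
        (\<Sum>i<m. B_odd_entry j (Suc i) * ?d i) - B_odd_entry j 1 * ?d 0"
    proof -
      have "(\<Sum>i<m. B_odd_entry j (Suc (Suc i)) * (if Suc i < m then ?d (Suc i) else 0)) =
          (\<Sum>i<p. B_odd_entry j (Suc (Suc i)) * ?d (Suc i))"
        unfolding p by simp
      then show ?thesis unfolding p by (simp add: sum.lessThan_Suc_shift del: sum.lessThan_Suc)
    qed
    have "(\<Sum>i<m. (B_odd_entry (Suc j) (Suc i) - 2 * B_odd_entry j (Suc i) +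
              B_odd_entry (j - 1) (Suc i)) * R_pow m r $$ (i, 0)) =
        (\<Sum>i<m. B_odd_entry j (Suc (Suc i)) * R_pow m r $$ (i, 0))"
      using j by (intro sum.cong refl) (subst B_odd_entry_second_difference, auto)
    also have "\<dots> = (\<Sum>i<m. B_odd_entry j (Suc (Suc i)) * (if Suc i < m then ?d (Suc i) else 0)) -
        (\<Sum>i<m. h_coeff m (Suc i) * B_odd_entry j (Suc (Suc i))) * ?d 0"
      unfolding sum_distrib_right sum_subtractf[symmetric]
      by (intro sum.cong refl) (subst R_pow_column_step, auto simp: algebra_simps)
    also have "\<dots> = (\<Sum>i<m. B_odd_entry j (Suc i) * ?d i)"
      unfolding hB shift by simp
    finally have *: "(\<Sum>i<m. B_odd_entry j (Suc i) * ?d i) =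
        (\<Sum>i<m. B_odd_entry (Suc j) (Suc i) * R_pow m r $$ (i, 0)) -
        2 * (\<Sum>i<m. B_odd_entry j (Suc i) * R_pow m r $$ (i, 0)) +
        (\<Sum>i<m. B_odd_entry (j - 1) (Suc i) * R_pow m r $$ (i, 0))"
      by (simp add: algebra_simps sum.distrib sum_subtractf sum_distrib_left)
    show ?thesis unfolding F_row_def * by (simp add: algebra_simps)
  qed
  show ?thesis
    unfolding second_difference_orbit_def odd_boundary_def second_difference_def
    using ends by (auto simp: step of_rat_add of_rat_diff of_rat_mult of_rat_minus)
qed

lemma F_row_0:
  assumes "j \<in> {1..m}"
  shows "F_row m 0 j = (if j = 1 then - of_nat (2 * m + 1) else 0)"
proof -
  have m: "m \<ge> 1" using assms by auto
  have "(\<Sum>i<m. B_odd_entry j (Suc i) * R_pow m 0 $$ (i, 0)) = 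
      (\<Sum>i<m. if i = 0 then B_odd_entry j 1 else 0)"
    using m by (intro sum.cong) (auto simp: R_pow_0)
  also have "\<dots> = (if j = 1 then -1 else 0)"
    using m assms by (auto simp: B_odd_entry_def)
  finally show ?thesis by (simp add: F_row_def)
qed

section \<open>Signed diagonals and their power sums\<close>

lemma signed_diag_minus [simp]: "signed_diag n (- k) = - signed_diag n k"
  by (simp add: signed_diag_def)

lemma signed_diag_multiple [simp]: "signed_diag n (int n * k) = 0"
  by (cases "n = 0") (simp_all add: signed_diag_def)

lemma signed_diag_nonneg:
  assumes "k \<le> n" shows "signed_diag n (int k) \<ge> 0"
  using assms by (cases "n = 0") (auto simp: signed_diag_def intro!: sin_ge_zero simp: field_simps)

lemma signed_diag_pos:
  assumes "0 < k" "k < n" shows "signed_diag n (int k) > 0"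
  using assms by (auto simp: signed_diag_def intro!: sin_gt_zero simp: field_simps)

lemma abs_signed_diag_cong:
  assumes "[a = b] (mod int n)" "n > 0"
  shows "\<bar>signed_diag n a\<bar> = \<bar>signed_diag n b\<bar>"
proof -
  obtain q where q: "a = b + int n * q"
    using assms(1) by (metis cong_iff_lin cong_sym)
  have "pi * of_int a / of_nat n = pi * of_int b / of_nat n + pi * of_int q"
    using assms(2) by (simp add: q field_simps)
  then have "sin (pi * of_int a / of_nat n) = sin (pi * of_int b / of_nat n) * cos (pi * of_int q)"
    by (simp add: sin_add)
  moreover have "\<bar>cos (pi * of_int q)\<bar> = 1"
    by (cases "even q") (simp_all add: cos_npi_int)
  ultimately show ?thesis by (simp add: signed_diag_def abs_mult)
qed

text \<open>Multiplication by \<open>(2 sin a)\<^sup>2\<close>, which equals \<open>2 - 2 cos (2 a)\<close>, acts on \<open>sin x\<close> as the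
  negative of a second difference with step \<open>2 a\<close>. For \<open>c = (2 j - 1) t\<close> the step \<open>2 t\<close> raises \<open>j\<close> by one.\<close>
lemma signed_diag_second_difference:
  "signed_diag n (c + 2 * t) - 2 * signed_diag n c + signed_diag n (c - 2 * t) =
     - (signed_diag n t)\<^sup>2 * signed_diag n c"
proof -
  define a x where "a = pi * of_int t / of_nat n" and "x = pi * of_int c / of_nat n"
  have "signed_diag n (c + 2 * t) = 2 * sin (x + 2 * a)" "signed_diag n (c - 2 * t) = 2 * sin (x - 2 * a)"
    "signed_diag n t = 2 * sin a" "signed_diag n c = 2 * sin x"
    by (simp_all add: signed_diag_def a_def x_def algebra_simps add_divide_distrib diff_divide_distrib)
  moreover have "2 * sin (x + 2 * a) - 2 * (2 * sin x) + 2 * sin (x - 2 * a) =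
      4 * sin x * (cos (2 * a) - 1)"
    by (simp only: sin_add sin_diff) (simp add: algebra_simps)
  moreover have "cos (2 * a) = 1 - 2 * (sin a)\<^sup>2" by (rule cos_double_sin)
  ultimately show ?thesis by (simp add: power_mult_distrib)
qed

lemma signed_diag_odd_multiples_diff:
  "signed_diag n ((2 * j + 1) * t) - signed_diag n ((2 * j - 1) * t) =
     signed_diag n t * (2 * cos (2 * of_int j * pi * of_int t / of_nat n))"
proof -
  define a x where "a = pi * of_int t / of_nat n" and "x = 2 * of_int j * pi * of_int t / of_nat n"
  have "signed_diag n ((2 * j + 1) * t) = 2 * sin (x + a)" "signed_diag n ((2 * j - 1) * t) = 2 * sin (x - a)"
    "signed_diag n t = 2 * sin a"
    by (simp_all add: signed_diag_def a_def x_def algebra_simps add_divide_distrib diff_divide_distrib)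
  then show ?thesis unfolding x_def[symmetric] by (simp add: sin_add sin_diff)
qed

definition diagonal_sum :: "nat \<Rightarrow> int \<Rightarrow> nat \<Rightarrow> real" where
  "diagonal_sum m r j = (-1) powi (r - 1) *
     (\<Sum>t=1..m. signed_diag (2 * m + 1) ((2 * int j - 1) * int t)
                  / signed_diag (2 * m + 1) (int t) powi (2 * r - 1))"

text \<open>Lowering \<open>r\<close> by one multiplies the summand of index \<open>t\<close> by minus the square of \<open>d t\<close>, which is a
  second difference in \<open>j\<close>. The diagonals themselves satisfy the boundary conditions, because
  \<open>d (- t) = - d t\<close> and \<open>d\<close> vanishes at multiples of \<open>2 m + 1\<close>.\<close>
lemma diagonal_sum_orbit:
  "second_difference_orbit UNIV m (diagonal_sum m)"
proof -
  let ?s = "signed_diag (2 * m + 1)"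
  have ends: "diagonal_sum m r 0 = - diagonal_sum m r 1" "diagonal_sum m r (Suc m) = 0" for r
  proof -
    show "diagonal_sum m r 0 = - diagonal_sum m r 1"
      by (simp add: diagonal_sum_def sum_negf)
    have "?s ((2 * int (Suc m) - 1) * int t) = 0" for t
      using signed_diag_multiple[of "2 * m + 1" "int t"] by (simp add: algebra_simps)
    then show "diagonal_sum m r (Suc m) = 0"
      unfolding diagonal_sum_def by simp
  qed
  have step: "diagonal_sum m (r - 1) j =
      diagonal_sum m r (Suc j) - 2 * diagonal_sum m r j + diagonal_sum m r (j - 1)"
    if j: "j \<in> {1..m}" for r j
  proof -
    let ?d = "\<lambda>t. ?s (int t) powi (2 * r - 1)"
    have summand: "?s ((2 * int (Suc j) - 1) * int t) / ?d t - 2 * (?s ((2 * int j - 1) * int t) / ?d t) +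
        ?s ((2 * int (j - 1) - 1) * int t) / ?d t =
        - (?s ((2 * int j - 1) * int t) / ?s (int t) powi (2 * (r - 1) - 1))"
      if t: "t \<in> {1..m}" for t
    proof -
      have s: "?s (int t) \<noteq> 0" using signed_diag_pos[of t "2 * m + 1"] t by auto
      have p: "?s (int t) powi (2 * (r - 1) - 1) = ?d t / (?s (int t))\<^sup>2"
        using power_int_diff[of "?s (int t)" "2 * r - 1" 2] s by (simp add: algebra_simps)
      have c: "(2 * int (Suc j) - 1) * int t = (2 * int j - 1) * int t + 2 * int t"
        "(2 * int (j - 1) - 1) * int t = (2 * int j - 1) * int t - 2 * int t"
        using j by (simp_all add: algebra_simps of_nat_diff)
      have "?s ((2 * int (Suc j) - 1) * int t) / ?d t - 2 * (?s ((2 * int j - 1) * int t) / ?d t) +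
          ?s ((2 * int (j - 1) - 1) * int t) / ?d t =
          (?s ((2 * int j - 1) * int t + 2 * int t) - 2 * ?s ((2 * int j - 1) * int t) +
           ?s ((2 * int j - 1) * int t - 2 * int t)) / ?d t"
        unfolding c by (simp add: diff_divide_distrib add_divide_distrib)
      also have "\<dots> = - (?s ((2 * int j - 1) * int t) / ?s (int t) powi (2 * (r - 1) - 1))"
        unfolding signed_diag_second_difference p by simp
      finally show ?thesis .
    qed
    have sg: "(-1) powi (r - 1 - 1) = - ((-1) powi (r - 1) :: real)"
    proof -
      have "(-1) powi (r - 1 - 1) = (-1) powi (r - 1) / (-1 :: real) powi 1"
        by (rule power_int_diff) simp
      then show ?thesis by (simp only: power_int_1_right divide_minus1)
    qed
    have "diagonal_sum m r (Suc j) - 2 * diagonal_sum m r j + diagonal_sum m r (j - 1) =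
        (-1) powi (r - 1) * (\<Sum>t=1..m. ?s ((2 * int (Suc j) - 1) * int t) / ?d t -
          2 * (?s ((2 * int j - 1) * int t) / ?d t) + ?s ((2 * int (j - 1) - 1) * int t) / ?d t)"
    proof -
      have "c * x - 2 * (c * y) + c * z = c * (x - 2 * y + z)" for c x y z :: real
        by (simp add: algebra_simps)
      then show ?thesis
        unfolding diagonal_sum_def sum.distrib sum_subtractf sum_distrib_left[symmetric] .
    qed
    also have "\<dots> = diagonal_sum m (r - 1) j"
    proof -
      have "(\<Sum>t=1..m. ?s ((2 * int (Suc j) - 1) * int t) / ?d t -
            2 * (?s ((2 * int j - 1) * int t) / ?d t) + ?s ((2 * int (j - 1) - 1) * int t) / ?d t) =
          (\<Sum>t=1..m. - (?s ((2 * int j - 1) * int t) / ?s (int t) powi (2 * (r - 1) - 1)))"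
        by (intro sum.cong refl summand)
      then show ?thesis
        unfolding diagonal_sum_def sg by (simp only: sum_negf mult_minus_right mult_minus_left)
    qed
    finally show ?thesis by simp
  qed
  show ?thesis
    unfolding second_difference_orbit_def odd_boundary_def second_difference_def
    by (intro ballI conjI ends step)
qed

text \<open>With \<open>\<theta> = k \<pi> / (2 m + 1)\<close>, multiplication by \<open>sin \<theta>\<close> makes the sum telescope to
  \<open>sin ((2 m + 1) \<theta>) - sin \<theta>\<close>, whose first term is \<open>sin (k \<pi>) = 0\<close>.\<close>
lemma sum_cos_roots:
  assumes "0 < k" "k < 2 * m + 1"
  shows "(\<Sum>t=1..m. 2 * cos (2 * real k * pi * real t / (2 * real m + 1))) = -1"
proof -
  define \<theta> where "\<theta> = real k * pi / (2 * real m + 1)"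
  have "sin \<theta> > 0"
  proof (rule sin_gt_zero)
    have "real k < 2 * real m + 1" using assms(2) by linarith
    then have "real k * pi < (2 * real m + 1) * pi" by simp
    then show "\<theta> < pi" by (simp add: \<theta>_def divide_less_eq mult.commute)
  qed (use assms in \<open>simp add: \<theta>_def add_pos_nonneg\<close>)
  have "sin \<theta> * (\<Sum>t=1..l. 2 * cos (2 * \<theta> * real t)) = sin ((2 * real l + 1) * \<theta>) - sin \<theta>" for l
  proof (induction l)
    case (Suc l)
    have "(2 * real (Suc l) + 1) * \<theta> = 2 * \<theta> * real (Suc l) + \<theta>"
      "(2 * real l + 1) * \<theta> = 2 * \<theta> * real (Suc l) - \<theta>"
      by (simp_all add: algebra_simps)
    then have "sin ((2 * real (Suc l) + 1) * \<theta>) - sin ((2 * real l + 1) * \<theta>) =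
        sin \<theta> * (2 * cos (2 * \<theta> * real (Suc l)))"
      by (simp only: sin_add sin_diff) simp
    then show ?case using Suc.IH by (simp add: distrib_left)
  qed simp
  from this[of m] have "sin \<theta> * (\<Sum>t=1..m. 2 * cos (2 * \<theta> * real t)) = sin (real k * pi) - sin \<theta>"
    by (simp add: \<theta>_def)
  then have "sin \<theta> * ((\<Sum>t=1..m. 2 * cos (2 * \<theta> * real t)) + 1) = 0"
    by (simp add: distrib_left)
  then have "(\<Sum>t=1..m. 2 * cos (2 * \<theta> * real t)) = -1" using \<open>sin \<theta> > 0\<close> by simp
  then show ?thesis by (simp add: \<theta>_def mult_ac)
qed

text \<open>At \<open>r = 0\<close> the summands are products of two sines, so the value for \<open>j > 1\<close> expresses
  that the vectors \<open>sin ((2 j - 1) \<pi> t / (2 m + 1))\<close>, \<open>1 \<le> t \<le> m\<close>, are orthogonal to the one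
  with \<open>j = 1\<close>.\<close>
lemma diagonal_sum_0:
  assumes j: "j \<in> {1..m}"
  shows "diagonal_sum m 0 j = (if j = 1 then - real (2 * m + 1) else 0)"
proof -
  let ?s = "signed_diag (2 * m + 1)"
  let ?c = "\<lambda>k. \<Sum>t=1..m. 2 * cos (2 * real k * pi * real t / (2 * real m + 1))"
  have prod: "?s ((2 * int j - 1) * int t) / ?s (int t) powi (2 * 0 - 1) =
      2 * cos (2 * real (j - 1) * pi * real t / (2 * real m + 1)) -
      2 * cos (2 * real j * pi * real t / (2 * real m + 1))" for t
  proof -
    define a where "a = pi * real t / (2 * real m + 1)"
    have s: "?s ((2 * int j - 1) * int t) = 2 * sin ((2 * real j - 1) * a)" "?s (int t) = 2 * sin a"
      by (simp_all add: signed_diag_def a_def mult_ac add_ac)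
    have c: "2 * real (j - 1) * pi * real t / (2 * real m + 1) = (2 * real j - 1) * a - a"
      "2 * real j * pi * real t / (2 * real m + 1) = (2 * real j - 1) * a + a"
      using j by (simp_all add: a_def of_nat_diff algebra_simps add_divide_distrib diff_divide_distrib)
    show ?thesis unfolding s c by (simp add: power_int_minus cos_add cos_diff) (simp add: divide_inverse)
  qed
  have "diagonal_sum m 0 j = - (?c (j - 1) - ?c j)"
    unfolding diagonal_sum_def prod sum_subtractf by simp
  moreover have "?c j = -1" using j by (intro sum_cos_roots) auto
  moreover have "?c (j - 1) = (if j = 1 then 2 * real m else -1)"
    using j sum_cos_roots[of "j - 1" m] by auto
  ultimately show ?thesis by simp
qed

lemma F_seq_eq_diagonal_sum:
  assumes "1 \<le> j" "j \<le> m + 1" "m \<ge> 1"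
  shows "real_of_rat (F_seq m j r) = diagonal_sum m r j"
proof (cases "j = m + 1")
  case True
  then show ?thesis using diagonal_sum_orbit[of m]
    by (simp add: F_seq_def second_difference_orbit_def odd_boundary_def)
next
  case False
  then have j: "j \<in> {1..m}" using assms by auto
  have "real_of_rat (F_row m r j) = diagonal_sum m r j"
  proof (rule orbit_eq[OF F_row_orbit diagonal_sum_orbit])
    fix k assume "k \<in> {1..m}"
    then show "real_of_rat (F_row m 0 k) = diagonal_sum m 0 k"
      by (auto simp: F_row_0 diagonal_sum_0 of_rat_minus of_rat_add of_rat_diff of_rat_mult)
  qed (use assms j in auto)
  then show ?thesis using assms by (simp add: F_seq_eq_F_row)
qed

section \<open>Fleck numbers\<close>

text \<open>A summation range \<open>M\<close> beyond \<open>N\<close> lets Pascal's rule be applied termwise.\<close>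
lemma fleck_eq_sum:
  assumes "N \<le> M"
  shows "fleck N a n = (\<Sum>k\<le>M. if [int k = a] (mod int n) then (-1) ^ k * int (N choose k) else 0)"
proof -
  have "(\<Sum>k\<le>M. if [int k = a] (mod int n) then (-1) ^ k * int (N choose k) else 0) =
      (\<Sum>k | k \<le> M \<and> [int k = a] (mod int n). (-1) ^ k * int (N choose k))"
    by (simp add: sum.If_cases Collect_conj_eq atMost_def)
  also have "\<dots> = fleck N a n"
    unfolding fleck_def using assms by (intro sum.mono_neutral_right) auto
  finally show ?thesis by simp
qed

lemma fleck_cong:
  assumes "[a = b] (mod int n)" shows "fleck N a n = fleck N b n"
  using assms unfolding fleck_def by (metis cong_sym cong_trans)

lemma fleck_Suc: "fleck (Suc N) a n = fleck N a n - fleck N (a - 1) n"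
proof -
  let ?i = "\<lambda>k (b::int) x. if [int k = b] (mod int n) then (x::int) else 0"
  have shift: "[1 + int k = a] (mod int n) \<longleftrightarrow> [int k = a - 1] (mod int n)" for k
    using cong_add_rcancel[of "int k" 1 "a - 1" "int n"] by (simp add: add.commute)
  have "fleck (Suc N) a n = ?i 0 a 1 +
      (\<Sum>k\<le>N. ?i (Suc k) a ((-1) ^ Suc k * int (Suc N choose Suc k)))"
    by (subst fleck_eq_sum[OF order_refl]) (simp only: sum.atMost_Suc_shift, simp)
  also have "\<dots> = (?i 0 a 1 + (\<Sum>k\<le>N. ?i (Suc k) a ((-1) ^ Suc k * int (N choose Suc k)))) -
      (\<Sum>k\<le>N. ?i (Suc k) a ((-1) ^ k * int (N choose k)))"
    by (simp add: sum_subtractf[symmetric] if_distrib cong: if_cong)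
       (intro sum.cong, auto simp: algebra_simps)
  also have "?i 0 a 1 + (\<Sum>k\<le>N. ?i (Suc k) a ((-1) ^ Suc k * int (N choose Suc k))) = fleck N a n"
    by (subst fleck_eq_sum[of N "Suc N"]) (simp, simp only: sum.atMost_Suc_shift, simp)
  also have "(\<Sum>k\<le>N. ?i (Suc k) a ((-1) ^ k * int (N choose k))) = fleck N (a - 1) n"
    by (simp add: fleck_eq_sum[OF order_refl] shift)
  finally show ?thesis .
qed

lemma fleck_reflect: "fleck N (int N - a) n = (-1) ^ N * fleck N a n"
proof -
  have *: "[int N - int k = int N - a] (mod int n) \<longleftrightarrow> [int k = a] (mod int n)" for k
    by (simp add: cong_iff_dvd_diff dvd_diff_commute)
  have "fleck N (int N - a) n = (\<Sum>k\<le>N. if [int (N - k) = int N - a] (mod int n)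
      then (-1) ^ (N - k) * int (N choose (N - k)) else 0)"
    unfolding fleck_eq_sum[OF order_refl]
    by (rule sum.reindex_bij_witness[of _ "\<lambda>k. N - k" "\<lambda>k. N - k"]) auto
  also have "\<dots> = (\<Sum>k\<le>N. (-1) ^ N * (if [int k = a] (mod int n) then (-1) ^ k * int (N choose k) else 0))"
    by (intro sum.cong refl)
       (auto simp: * of_nat_diff binomial_symmetric[symmetric] minus_one_power_iff)
  finally show ?thesis
    by (simp add: fleck_eq_sum[OF order_refl] sum_distrib_left)
qed

text \<open>Lowering \<open>r\<close> by one raises \<open>N = 1 - 2 r\<close> by two and the residue by one, so Pascal's rule
  applied twice is the second difference. The boundary conditions come from the reflection
  \<open>k \<mapsto> N - k\<close> for odd \<open>N\<close>: it interchanges the residues \<open>- r\<close> and \<open>1 - r\<close>, and it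
  fixes the residue \<open>m + 1 - r\<close> modulo \<open>2 m + 1\<close>, whose Fleck number is therefore its own negative.\<close>
lemma fleck_orbit:
  "second_difference_orbit {..0} m
     (\<lambda>r j. of_int (int (2 * m + 1) * fleck (nat (1 - 2 * r)) (int j - r) (2 * m + 1)))"
proof -
  let ?n = "2 * m + 1"
  let ?f = "\<lambda>r j. fleck (nat (1 - 2 * r)) (int j - r) ?n"
  have refl: "fleck (nat (1 - 2 * r)) (1 - 2 * r - a) ?n = - fleck (nat (1 - 2 * r)) a ?n"
    if "r \<le> 0" for r a
  proof -
    have "int (nat (1 - 2 * r)) = 1 - 2 * r" "odd (nat (1 - 2 * r))"
      using that by (auto simp: even_nat_iff)
    then show ?thesis using fleck_reflect[of "nat (1 - 2 * r)" a ?n] by simp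
  qed
  have left: "?f r 0 = - ?f r 1" if "r \<le> 0" for r
    using refl[OF that, of "1 - r"] by simp
  have right: "?f r (Suc m) = 0" if "r \<le> 0" for r
  proof -
    have "[1 - 2 * r - (int (Suc m) - r) = int (Suc m) - r] (mod int ?n)"
    proof -
      have "1 - 2 * r - (int (Suc m) - r) - (int (Suc m) - r) = int ?n * (-1)" by simp
      then show ?thesis unfolding cong_iff_dvd_diff by (simp only: dvd_triv_left)
    qed
    from fleck_cong[OF this] show ?thesis using refl[OF that, of "int (Suc m) - r"] by simp
  qed
  have step: "?f (r - 1) j = ?f r (Suc j) - 2 * ?f r j + ?f r (j - 1)"
    if "r \<le> 0" "j \<in> {1..m}" for r j
  proof -
    have "nat (1 - 2 * (r - 1)) = Suc (Suc (nat (1 - 2 * r)))" using that(1) by simp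
    then show ?thesis using that(2)
      by (simp add: fleck_Suc of_nat_diff algebra_simps)
  qed
  show ?thesis
    unfolding second_difference_orbit_def odd_boundary_def second_difference_def
  proof (intro ballI conjI)
    fix r :: int assume "r \<in> {..0}"
    then have r: "r \<le> 0" by simp
    show "real_of_int (int ?n * ?f r 0) = - real_of_int (int ?n * ?f r 1)"
      by (simp only: left[OF r] mult_minus_right of_int_minus)
    show "real_of_int (int ?n * ?f r (Suc m)) = 0"
      by (simp only: right[OF r] mult_zero_right of_int_0)
    fix j assume j: "j \<in> {1..m}"
    have "real_of_int (c * (x - 2 * y + z)) =
        real_of_int (c * x) - 2 * real_of_int (c * y) + real_of_int (c * z)" for c x y z
      by (simp add: algebra_simps)
    then show "real_of_int (int ?n * ?f (r - 1) j) = real_of_int (int ?n * ?f r (Suc j)) -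
        2 * real_of_int (int ?n * ?f r j) + real_of_int (int ?n * ?f r (j - 1))"
      unfolding step[OF r j] .
  qed
qed

lemma diagonal_sum_eq_fleck:
  assumes "r \<le> 0" "1 \<le> j" "j \<le> m + 1" "m \<ge> 1"
  shows "diagonal_sum m r j =
     of_int (int (2 * m + 1) * fleck (nat (1 - 2 * r)) (int j - r) (2 * m + 1))"
proof (cases "j = m + 1")
  case True
  then show ?thesis using diagonal_sum_orbit[of m] fleck_orbit[of m] assms(1)
    by (simp add: second_difference_orbit_def odd_boundary_def)
next
  case False
  have D: "second_difference_orbit {..0} m (diagonal_sum m)"
    using diagonal_sum_orbit by (auto simp: second_difference_orbit_def)
  have zero: "diagonal_sum m 0 k =
      of_int (int (2 * m + 1) * fleck (nat (1 - 2 * 0)) (int k - 0) (2 * m + 1))"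
    if k: "k \<in> {1..m}" for k
  proof -
    \<comment> \<open>For \<open>r = 0\<close> the binomial coefficients are those of \<open>1 - x\<close>; only the exponent \<open>1\<close> is
      congruent to some \<open>k\<close> in the range.\<close>
    have "\<not> [0 = int k] (mod int (2 * m + 1))" 
      using k by (auto simp: cong_iff_dvd_diff dest: zdvd_imp_le)
    moreover have "[1 = int k] (mod int (2 * m + 1)) \<longleftrightarrow> k = 1"
      using k by (auto simp: cong_def)
    ultimately have "fleck 1 (int k) (2 * m + 1) = (if k = 1 then -1 else 0)"
      by (simp add: fleck_eq_sum[OF order_refl])
    then show ?thesis using k by (simp add: diagonal_sum_0)
  qed
  show ?thesis
    using orbit_eq_backward[OF D fleck_orbit zero] assms False by auto
qed

section \<open>Distances between the vertices\<close>

lemma dist_cis: "dist (cis a) (cis b) = 2 * \<bar>sin ((a - b) / 2)\<bar>"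
proof -
  define c where "c = (a - b) / 2"
  then have c: "a - b = 2 * c" by simp
  have "(dist (cis a) (cis b))\<^sup>2 = (cos a - cos b)\<^sup>2 + (sin a - sin b)\<^sup>2"
    by (simp add: dist_norm cmod_power2)
  also have "\<dots> = ((sin a)\<^sup>2 + (cos a)\<^sup>2) + ((sin b)\<^sup>2 + (cos b)\<^sup>2) - 2 * cos (a - b)"
    by (simp only: cos_diff) (simp add: power2_eq_square algebra_simps)
  also have "\<dots> = 2 - 2 * cos (2 * c)" by (simp add: c)
  also have "\<dots> = (2 * \<bar>sin c\<bar>)\<^sup>2"
    by (simp only: cos_double_sin) (simp add: power_mult_distrib)
  finally show ?thesis unfolding c_def by (rule power2_eq_imp_eq) auto
qed

lemma dist_inscribed_regular_polygon:
  assumes "inscribed_regular_polygon n v" "k < n" "l < n"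
  shows "dist (v k) (v l) = \<bar>signed_diag n (int k - int l)\<bar>"
proof -
  \<comment> \<open>The sign \<open>s\<close> is the orientation in which the vertices are listed.\<close>
  obtain \<theta> :: real and s :: real where s: "s = 1 \<or> s = -1"
    and v: "\<forall>k<n. v k = cis (\<theta> + s * (2 * pi * of_nat k / of_nat n))"
  proof -
    from assms(1) obtain \<theta> :: real where
      "(\<forall>k<n. v k = cis (\<theta> + 2 * pi * of_nat k / of_nat n)) \<or>
       (\<forall>k<n. v k = cis (\<theta> - 2 * pi * of_nat k / of_nat n))"
      unfolding inscribed_regular_polygon_def by blast
    then show ?thesis using that[of 1 \<theta>] that[of "-1" \<theta>] by auto
  qed
  have "(\<theta> + s * (2 * pi * real k / real n) - (\<theta> + s * (2 * pi * real l / real n))) / 2 =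
      s * (pi * of_int (int k - int l) / real n)"
    by (simp add: algebra_simps diff_divide_distrib)
  moreover have "\<bar>sin (s * x)\<bar> = \<bar>sin x\<bar>" for x
    using s by auto
  ultimately show ?thesis using assms(2,3) v by (simp only: dist_cis) (simp add: signed_diag_def abs_mult)
qed

theorem theorem5:
  fixes m n :: nat and v :: "nat \<Rightarrow> complex"
  assumes "m \<ge> 1" and "n = 2 * m + 1" and "inscribed_regular_polygon n v"
  shows
    "(\<forall>k<n. signed_diag n (int k) = dist (v 0) (v k)) \<and>
     (\<forall>k::int. \<bar>signed_diag n k\<bar> = dist (v 0) (v (nat (k mod int n)))) \<and>
     (\<forall>k<n. signed_diag n 1 = dist (v k) (v ((k + 1) mod n))) \<and>
     signed_diag n (int n) = 0 \<and>
     (\<forall>j\<in>{1..m}. \<forall>r::int.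
        real_of_rat (F_seq m j r) =
          (-1) powi (r - 1) *
            (\<Sum>t=1..m. signed_diag n ((2 * int j - 1) * int t)
                        / signed_diag n (int t) powi (2 * r - 1)) \<and>
        real_of_rat (F_seq m j r) =
          (-1) powi (r - 1) *
            (\<Sum>t=1..m. (2 * sin ((2 * real j - 1) * pi * real t / (2 * real m + 1)))
                        / (2 * sin (pi * real t / (2 * real m + 1))) powi (2 * r - 1)) \<and>
        G_seq m j r = F_seq m (j + 1) r - F_seq m j r \<and>
        real_of_rat (G_seq m j r) =
          (-1) powi (r - 1) *
            (\<Sum>t=1..m. (signed_diag n ((2 * int j + 1) * int t)
                          - signed_diag n ((2 * int j - 1) * int t))
                        / signed_diag n (int t) powi (2 * r - 1)) \<and>
        real_of_rat (G_seq m j r) =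
          (-1) powi (r - 1) *
            (\<Sum>t=1..m. (2 * cos (2 * real j * pi * real t / (2 * real m + 1)))
                        / (2 * sin (pi * real t / (2 * real m + 1))) powi (2 * r - 2)) \<and>
        (r < 0 \<longrightarrow>
          (-1) powi (r - 1) *
            (\<Sum>t=1..m. signed_diag n ((2 * int j - 1) * int t)
                        / signed_diag n (int t) powi (2 * r - 1))
            = of_int (int n * fleck (nat (1 - 2 * r)) (int j - r) n) \<and>
          (-1) powi (r - 1) *
            (\<Sum>t=1..m. (signed_diag n ((2 * int j + 1) * int t)
                          - signed_diag n ((2 * int j - 1) * int t))
                        / signed_diag n (int t) powi (2 * r - 1))
            = of_int (int n * fleck (nat (2 - 2 * r)) (int j + 1 - r) n)))"
proof (intro conjI allI ballI impI)
  note poly = dist_inscribed_regular_polygon[OF assms(3)]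
  have n: "n > 0" "n > 1" using assms by auto
  show "signed_diag n (int k) = dist (v 0) (v k)" if "k < n" for k
    using that poly[of 0 k] signed_diag_nonneg[of k n] n by simp
  show "\<bar>signed_diag n k\<bar> = dist (v 0) (v (nat (k mod int n)))" for k
  proof -
    have "k mod int n \<ge> 0" "k mod int n < int n" using n by auto
    then have "dist (v 0) (v (nat (k mod int n))) = \<bar>signed_diag n (k mod int n)\<bar>"
      using poly[of 0 "nat (k mod int n)"] n by (simp add: nat_less_iff)
    also have "\<dots> = \<bar>signed_diag n k\<bar>"
      using n by (intro abs_signed_diag_cong) (auto simp: cong_def)
    finally show ?thesis by simp
  qed
  show "signed_diag n 1 = dist (v k) (v ((k + 1) mod n))" if "k < n" for k
  proof -
    have "[int k - int ((k + 1) mod n) = int k - int (k + 1)] (mod int n)"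
      by (intro cong_diff cong_refl) (simp add: cong_def zmod_int)
    then have "\<bar>signed_diag n (int k - int ((k + 1) mod n))\<bar> = \<bar>signed_diag n (- 1)\<bar>"
      using n by (intro abs_signed_diag_cong) auto
    then show ?thesis
      using that poly[of k "(k + 1) mod n"] signed_diag_nonneg[of 1 n] n by simp
  qed
  show "signed_diag n (int n) = 0"
    using signed_diag_multiple[of n 1] by simp
  fix j :: nat and r :: int
  assume j: "j \<in> {1..m}"
  let ?s = "signed_diag n"
  have F: "real_of_rat (F_seq m k r) = diagonal_sum m r k" if "k \<in> {j, j + 1}" for k
    using that j by (intro F_seq_eq_diagonal_sum) auto
  have sum: "diagonal_sum m r j = (-1) powi (r - 1) *
      (\<Sum>t=1..m. ?s ((2 * int j - 1) * int t) / ?s (int t) powi (2 * r - 1))"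
    by (simp add: diagonal_sum_def assms(2))
  have sin: "?s (int t) = 2 * sin (pi * real t / (2 * real m + 1))"
    "?s ((2 * int j - 1) * int t) = 2 * sin ((2 * real j - 1) * pi * real t / (2 * real m + 1))" for t
    by (simp_all add: signed_diag_def assms(2) mult_ac add_ac)
  have diff: "(-1) powi (r - 1) * (\<Sum>t=1..m. (?s ((2 * int j + 1) * int t)
        - ?s ((2 * int j - 1) * int t)) / ?s (int t) powi (2 * r - 1)) =
      diagonal_sum m r (j + 1) - diagonal_sum m r j"
    by (simp add: diagonal_sum_def assms(2) diff_divide_distrib sum_subtractf right_diff_distrib
        add_ac)
  show F1: "real_of_rat (F_seq m j r) = (-1) powi (r - 1) *
      (\<Sum>t=1..m. ?s ((2 * int j - 1) * int t) / ?s (int t) powi (2 * r - 1))"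
    using F sum by simp
  show "real_of_rat (F_seq m j r) = (-1) powi (r - 1) *
      (\<Sum>t=1..m. (2 * sin ((2 * real j - 1) * pi * real t / (2 * real m + 1)))
                  / (2 * sin (pi * real t / (2 * real m + 1))) powi (2 * r - 1))"
    unfolding F1 sin ..
  show G: "G_seq m j r = F_seq m (j + 1) r - F_seq m j r"
    using j by (simp add: G_seq_eq_F_row F_seq_eq_F_row)
  show G1: "real_of_rat (G_seq m j r) = (-1) powi (r - 1) *
      (\<Sum>t=1..m. (?s ((2 * int j + 1) * int t) - ?s ((2 * int j - 1) * int t))
                  / ?s (int t) powi (2 * r - 1))"
    unfolding diff G using F by (simp add: of_rat_diff)
  show "real_of_rat (G_seq m j r) = (-1) powi (r - 1) *
      (\<Sum>t=1..m. (2 * cos (2 * real j * pi * real t / (2 * real m + 1)))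
                  / (2 * sin (pi * real t / (2 * real m + 1))) powi (2 * r - 2))"
  proof -
    have "(?s ((2 * int j + 1) * int t) - ?s ((2 * int j - 1) * int t)) / ?s (int t) powi (2 * r - 1) =
        (2 * cos (2 * real j * pi * real t / (2 * real m + 1))) / ?s (int t) powi (2 * r - 2)"
      if "t \<in> {1..m}" for t
    proof -
      have s: "?s (int t) \<noteq> 0" using signed_diag_pos[of t n] that assms(2) by auto
      then have "?s (int t) powi (2 * r - 1) = ?s (int t) * ?s (int t) powi (2 * r - 2)"
        using power_int_add_1'[of "?s (int t)" "2 * r - 2"] by simp
      then show ?thesis
        using s unfolding signed_diag_odd_multiples_diff by (simp add: assms(2) add_ac)
    qed
    then show ?thesis unfolding G1 sin(1)[symmetric] by (intro arg_cong2[of _ _ _ _ "(*)"] sum.cong refl)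
  qed
  assume r: "r < 0"
  have fleck: "diagonal_sum m r k = of_int (int n * fleck (nat (1 - 2 * r)) (int k - r) n)"
    if "k \<in> {j, j + 1}" for k
    unfolding assms(2) using that j r by (intro diagonal_sum_eq_fleck) auto
  show "(-1) powi (r - 1) *
      (\<Sum>t=1..m. ?s ((2 * int j - 1) * int t) / ?s (int t) powi (2 * r - 1)) =
      of_int (int n * fleck (nat (1 - 2 * r)) (int j - r) n)"
    using fleck sum by simp
  have "nat (2 - 2 * r) = Suc (nat (1 - 2 * r))" using r by simp
  then show "(-1) powi (r - 1) * (\<Sum>t=1..m. (?s ((2 * int j + 1) * int t)
        - ?s ((2 * int j - 1) * int t)) / ?s (int t) powi (2 * r - 1)) =
      of_int (int n * fleck (nat (2 - 2 * r)) (int j + 1 - r) n)"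
    unfolding diff using fleck by (simp add: fleck_Suc algebra_simps)
qed

end
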